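(* Let $m\geqslant 2$ be an integer and let $G$ be a finite group of order $q$. Then the adjacency matrix of the diagonal graph $\Gamma_D(G,m)$ has, for each $k\in\{0,\ldots,m-1\}$, eigenvalue $-(m+1)+kq$ with multiplicity \[ \binom{m+1}{k}\,q^{-1}(q-1)\bigl((q-1)^{m-k}-(-1)^{m-k}\bigr), \] and eigenvalue $(m+1)(q-1)$ with multiplicity $1$. These are all the eigenvalues (where a value whose stated multiplicity is $0$ is not an eigenvalue).
   Context: Diagonal graph: for a group $G$ and an integer $m\geqslant 1$, let $\Omega=G^m$. For $1\leqslant i\leqslant m$, let $Q_i$ be the partition of $\Omega$ in which $(g_1,\ldots,g_m)$ and $(h_1,\ldots,h_m)$ are in the same part if and only if $g_j=h_j$ for all $j\neq i$. Let $Q_0$ be the partition in which $(g_1,\ldots,g_m)$ and $(h_1,\ldots,h_m)$ are in the same part if and only if there is $x\in G$ with $h_i=xg_i$ for all $i$. The diagonal graph $\Gamma_D(G,m)$ is the simple graph with vertex set $\Omega$ in which two distinct vertices are adjacent if and only if they lie in the same part of at least one of $Q_0,Q_1,\ldots,Q_m$. *)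

theory Defs
  imports "HOL-Algebra.Coset" "Graph_Theory.Pair_Digraph" "Jordan_Normal_Form.Char_Poly"
begin

text \<open>Tuples in \<open>G\<^sup>m\<close> are functions on \<open>{1..m}\<close>, extensional so that equality of tuples is
  equality of functions.\<close>

definition diag_vertices :: "('a, 'b) monoid_scheme \<Rightarrow> nat \<Rightarrow> (nat \<Rightarrow> 'a) set" where
  "diag_vertices G m = {1..m} \<rightarrow>\<^sub>E carrier G"

definition diag_rel ::
  "('a, 'b) monoid_scheme \<Rightarrow> nat \<Rightarrow> nat \<Rightarrow> ((nat \<Rightarrow> 'a) \<times> (nat \<Rightarrow> 'a)) set" where
  "diag_rel G m i = {(g, h) \<in> diag_vertices G m \<times> diag_vertices G m.
     if i = 0 then \<exists>x \<in> carrier G. \<forall>j \<in> {1..m}. h j = x \<otimes>\<^bsub>G\<^esub> g j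
     else \<forall>j \<in> {1..m}. j \<noteq> i \<longrightarrow> g j = h j}"

definition diag_partition ::
  "('a, 'b) monoid_scheme \<Rightarrow> nat \<Rightarrow> nat \<Rightarrow> (nat \<Rightarrow> 'a) set set" where
  "diag_partition G m i = diag_vertices G m // diag_rel G m i"

text \<open>A simple graph is a loop-free digraph with a symmetric arc set.\<close>

definition diagonal_graph ::
  "('a, 'b) monoid_scheme \<Rightarrow> nat \<Rightarrow> (nat \<Rightarrow> 'a) pair_pre_digraph" where
  "diagonal_graph G m = \<lparr> pverts = diag_vertices G m,
     parcs = {(g, h) \<in> diag_vertices G m \<times> diag_vertices G m. g \<noteq> h \<and>
       (\<exists>i \<in> {0..m}. \<exists>P \<in> diag_partition G m i. g \<in> P \<and> h \<in> P)} \<rparr>"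

text \<open>Rows and columns are indexed by the position in an enumeration \<open>vs\<close> of the vertices.\<close>

definition adjacency_matrix :: "'v pair_pre_digraph \<Rightarrow> 'v list \<Rightarrow> 'c :: {zero,one} mat" where
  "adjacency_matrix \<Gamma> vs = mat (length vs) (length vs)
     (\<lambda>(i, j). if (vs ! i, vs ! j) \<in> parcs \<Gamma> then 1 else 0)"

lemma equiv_diag_rel:
  assumes "Group.group G"
  shows "equiv (diag_vertices G m) (diag_rel G m i)"
proof -
  interpret Group.group G by fact
  show ?thesis
  proof (cases "i = 0")
    case True
    show ?thesis
    proof (rule equivI)
      show "refl_on (diag_vertices G m) (diag_rel G m i)"
        unfolding refl_on_def diag_rel_def using True
        by (auto simp: diag_vertices_def PiE_iff intro!: bexI[of _ "\<one>\<^bsub>G\<^esub>"])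
      show "sym (diag_rel G m i)"
      proof (rule symI)
        fix g h assume gh: "(g, h) \<in> diag_rel G m i"
        then obtain x where x: "x \<in> carrier G" "\<forall>j\<in>{1..m}. h j = x \<otimes>\<^bsub>G\<^esub> g j"
          using True by (auto simp: diag_rel_def)
        have "\<forall>j\<in>{1..m}. g j \<in> carrier G"
          using gh by (auto simp: diag_rel_def diag_vertices_def PiE_iff)
        hence "\<forall>j\<in>{1..m}. g j = inv\<^bsub>G\<^esub> x \<otimes>\<^bsub>G\<^esub> h j"
          using x by (simp add: m_assoc[symmetric])
        with gh x(1) True show "(h, g) \<in> diag_rel G m i"
          by (auto simp: diag_rel_def intro!: bexI[of _ "inv\<^bsub>G\<^esub> x"])
      qed
      show "trans (diag_rel G m i)"
      proof (rule transI)
        fix f g h assume fg: "(f, g) \<in> diag_rel G m i" and gh: "(g, h) \<in> diag_rel G m i"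
        obtain x where x: "x \<in> carrier G" "\<forall>j\<in>{1..m}. g j = x \<otimes>\<^bsub>G\<^esub> f j"
          using True fg by (auto simp: diag_rel_def)
        obtain y where y: "y \<in> carrier G" "\<forall>j\<in>{1..m}. h j = y \<otimes>\<^bsub>G\<^esub> g j"
          using True gh by (auto simp: diag_rel_def)
        have "\<forall>j\<in>{1..m}. f j \<in> carrier G"
          using fg by (auto simp: diag_rel_def diag_vertices_def PiE_iff)
        hence "\<forall>j\<in>{1..m}. h j = (y \<otimes>\<^bsub>G\<^esub> x) \<otimes>\<^bsub>G\<^esub> f j"
          using x y by (simp add: m_assoc)
        with fg gh x(1) y(1) True show "(f, h) \<in> diag_rel G m i"
          by (auto simp: diag_rel_def intro!: bexI[of _ "y \<otimes>\<^bsub>G\<^esub> x"])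
      qed
    qed (auto simp: diag_rel_def)
  next
    case False
    thus ?thesis
      by (auto simp: diag_rel_def intro!: equivI refl_onI symI transI)
  qed
qed

lemma pair_graph_diagonal_graph:
  assumes "Group.group G" "finite (carrier G)"
  shows "pair_graph (diagonal_graph G m)"
proof
  have fin: "finite (diag_vertices G m)"
    unfolding diag_vertices_def using assms(2) by (intro finite_PiE) auto
  show "finite (pverts (diagonal_graph G m))"
    using fin by (simp add: diagonal_graph_def)
  show "finite (parcs (diagonal_graph G m))"
    by (rule finite_subset[of _ "diag_vertices G m \<times> diag_vertices G m"])
       (use fin in \<open>auto simp: diagonal_graph_def\<close>)
  have "sym (parcs (diagonal_graph G m))"
    by (rule symI) (auto simp: diagonal_graph_def)
  thus "symmetric (with_proj (diagonal_graph G m))"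
    by (simp add: symmetric_def)
qed (auto simp: diagonal_graph_def)

end

theory Submission
  imports Defs "Jordan_Normal_Form.Schur_Decomposition"
begin

text \<open>Let \<open>E\<^sub>i\<close> average functions on the vertices over the parts of \<open>Q\<^sub>i\<close>. Since \<open>m \<ge> 2\<close>, two distinct
  vertices share a part of at most one \<open>Q\<^sub>i\<close>, so the adjacency matrix is the sum of the
  \<open>q E\<^sub>i - I\<close> over \<open>0 \<le> i \<le> m\<close>. The \<open>E\<^sub>i\<close> are commuting idempotents; hence the space splits into the pieces,
  one for each \<open>S \<subseteq> {0..m}\<close>, on which \<open>E\<^sub>i\<close> is the identity for \<open>i \<in> S\<close> and zero otherwise, and the
  adjacency matrix acts there as \<open>|S| q - (m + 1)\<close>. The dimension of a piece is the trace of its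
  projection, an alternating sum of the traces \<open>q\<^sup>m\<^sup>-\<^sup>|\<^sup>T\<^sup>|\<close> (1 if \<open>T = {0..m}\<close>) of the products of the \<open>E\<^sub>i\<close>
  with \<open>i \<in> T\<close>. No eigenbasis is needed: the traces of all powers of the matrix determine the
  multiplicities of its eigenvalues.\<close>

section \<open>Linear algebra: traces of powers and multiplicities of eigenvalues\<close>

lemma trace_mult_commute:
  fixes A B :: "'a :: comm_semiring_0 mat"
  assumes A: "A \<in> carrier_mat n m" and B: "B \<in> carrier_mat m n"
  shows "(\<Sum>i<n. (A * B) $$ (i, i)) = (\<Sum>i<m. (B * A) $$ (i, i))"
proof -
  have "(\<Sum>i<n. (A * B) $$ (i, i)) = (\<Sum>i<n. \<Sum>k<m. A $$ (i, k) * B $$ (k, i))"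
    using A B by (intro sum.cong refl) (auto simp: scalar_prod_def atLeast0LessThan)
  also have "\<dots> = (\<Sum>k<m. \<Sum>i<n. A $$ (i, k) * B $$ (k, i))"
    by (rule sum.swap)
  also have "\<dots> = (\<Sum>k<m. (B * A) $$ (k, k))"
    using A B by (intro sum.cong refl) (auto simp: scalar_prod_def atLeast0LessThan mult.commute)
  finally show ?thesis .
qed

lemma trace_similar_mat_wit:
  fixes A B :: "'a :: comm_semiring_1 mat"
  assumes "similar_mat_wit A B P Q" and A: "A \<in> carrier_mat n n"
  shows "(\<Sum>i<n. A $$ (i, i)) = (\<Sum>i<n. B $$ (i, i))"
proof -
  have n: "n = dim_row A"
    using A by simp
  note w = similar_mat_witD[OF n assms(1)]
  have "(\<Sum>i<n. A $$ (i, i)) = (\<Sum>i<n. (P * (B * Q)) $$ (i, i))"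
    using w(3) unfolding assoc_mult_mat[OF w(6,5,7)] by simp
  also have "\<dots> = (\<Sum>i<n. ((B * Q) * P) $$ (i, i))"
    by (rule trace_mult_commute[OF w(6) mult_carrier_mat[OF w(5,7)]])
  also have "(B * Q) * P = B"
    unfolding assoc_mult_mat[OF w(5,7,6)] w(2) by (rule right_mult_one_mat[OF w(5)])
  finally show ?thesis .
qed

text \<open>Both claims go through one induction: the diagonal entries of the next power collapse to
  a single product only because the previous power is itself triangular.\<close>

lemma upper_triangular_pow_mat:
  fixes B :: "'a :: comm_semiring_1 mat"
  assumes B: "B \<in> carrier_mat n n" and ut: "upper_triangular B"
  shows "upper_triangular (B ^\<^sub>m r) \<and> (\<forall>i<n. (B ^\<^sub>m r) $$ (i, i) = B $$ (i, i) ^ r)"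
proof (induction r)
  case 0
  have "B ^\<^sub>m 0 = 1\<^sub>m n"
    by (simp only: pow_mat.simps carrier_matD(1)[OF B])
  then show ?case by (simp add: upper_triangular_one)
next
  case (Suc r)
  define C where "C = B ^\<^sub>m r"
  have C: "C \<in> carrier_mat n n" using B by (simp add: C_def)
  have utC: "upper_triangular C" using Suc by (simp add: C_def)
  have C0: "C $$ (i, j) = 0" if "j < i" "i < n" for i j
    using upper_triangularD[OF utC that(1)] that C by simp
  have B0: "B $$ (i, j) = 0" if "j < i" "i < n" for i j
    using upper_triangularD[OF ut that(1)] that B by simp
  have entry: "(C * B) $$ (i, j) = (\<Sum>k<n. C $$ (i, k) * B $$ (k, j))" if "i < n" "j < n" for i j
    using that B C by (auto simp: scalar_prod_def atLeast0LessThan)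
  have "(C * B) $$ (i, j) = 0" if ij: "j < i" "i < n" for i j
  proof -
    have "C $$ (i, k) * B $$ (k, j) = 0" if "k < n" for k
      using C0[of k i] B0[of j k] that ij by (cases "k < i") simp_all
    then show ?thesis using ij by (simp add: entry)
  qed
  then have "upper_triangular (C * B)" using C by (intro upper_triangularI) simp
  moreover have "(C * B) $$ (i, i) = B $$ (i, i) ^ Suc r" if i: "i < n" for i
  proof -
    have "C $$ (i, k) * B $$ (k, i) = (if k = i then C $$ (i, i) * B $$ (i, i) else 0)" if "k < n" for k
      using C0[of k i] B0[of i k] that i by (cases k i rule: linorder_cases) simp_all
    then have "(C * B) $$ (i, i) = (\<Sum>k<n. if k = i then C $$ (i, i) * B $$ (i, i) else 0)"
      unfolding entry[OF i i] by (intro sum.cong refl) (simp only: lessThan_iff)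
    also have "\<dots> = C $$ (i, i) * B $$ (i, i)"
      using i by simp
    also have "C $$ (i, i) = B $$ (i, i) ^ r"
      using Suc i by (simp only: C_def simp_thms)
    finally show ?thesis by (simp only: power_Suc2)
  qed
  ultimately show ?case by (simp only: C_def pow_mat.simps) blast
qed

text \<open>\<open>pow_mat\<close> appends factors on the right; the adjacency matrix will act on
  projections from the left.\<close>

lemma pow_mat_Suc_left:
  fixes A :: "'a :: semiring_1 mat"
  assumes A: "A \<in> carrier_mat n n"
  shows "A ^\<^sub>m Suc r = A * A ^\<^sub>m r"
proof (induction r)
  case 0
  then show ?case using left_mult_one_mat[OF A] right_mult_one_mat[OF A] A by simp
next
  case (Suc r)
  have "A ^\<^sub>m Suc (Suc r) = (A * A ^\<^sub>m r) * A"
    unfolding pow_mat.simps(2)[of A "Suc r"] Suc ..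
  then show ?case
    using assoc_mult_mat[OF A pow_carrier_mat[OF A] A, of r] by simp
qed

lemma order_prod_linear_factors:
  fixes z :: "'a :: field"
  shows "Polynomial.order z (\<Prod>a\<leftarrow>es. [:- a, 1:]) = card {i. i < length es \<and> es ! i = z}"
proof (induction es)
  case Nil
  then show ?case by simp
next
  case (Cons a es)
  have ne: "(\<Prod>a\<leftarrow>es. [:- a, 1:]) \<noteq> 0"
    by (auto simp: prod_list_zero_iff)
  have lin: "Polynomial.order z [:- a, 1:] = (if a = z then 1 else 0)"
  proof (cases "a = z")
    case True
    then show ?thesis using order_power_n_n[of z 1] by simp
  next
    case False
    then show ?thesis by (simp add: order_0I)
  qed
  have "{i. i < length (a # es) \<and> (a # es) ! i = z} =
      (if a = z then {0} else {}) \<union> Suc ` {i. i < length es \<and> es ! i = z}"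
    (is "?L = ?R")
  proof (rule Set.set_eqI)
    show "i \<in> ?L \<longleftrightarrow> i \<in> ?R" for i
      by (cases i) auto
  qed
  then have "card {i. i < length (a # es) \<and> (a # es) ! i = z} =
      (if a = z then 1 else 0) + card {i. i < length es \<and> es ! i = z}"
    by (simp add: card_image)
  moreover have "Polynomial.order z (\<Prod>a\<leftarrow>a # es. [:- a, 1:]) =
      (if a = z then 1 else 0) + Polynomial.order z (\<Prod>a\<leftarrow>es. [:- a, 1:])"
  proof -
    have "[:- a, 1:] * (\<Prod>a\<leftarrow>es. [:- a, 1:]) \<noteq> 0"
      using ne by (simp only: mult_eq_0_iff) simp
    from order_mult[OF this, of z] show ?thesis
      by (simp only: list.map prod_list.Cons lin)
  qed
  ultimately show ?case using Cons.IH by (simp only:)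
qed

text \<open>By linearity, equal power sums give equal weighted sums of the values of every
  polynomial. A polynomial that vanishes at all occurring values except \<open>z\<close> isolates
  the weight of \<open>z\<close>, up to the nonzero factor \<open>poly p z\<close>.\<close>

lemma power_sums_determine_weights:
  fixes a b :: "_ \<Rightarrow> 'a :: field"
  assumes I: "finite I" and J: "finite J"
    and eq: "\<And>r. (\<Sum>i\<in>I. a i * x i ^ r) = (\<Sum>j\<in>J. b j * y j ^ r)"
  shows "(\<Sum>i\<in>{i\<in>I. x i = z}. a i) = (\<Sum>j\<in>{j\<in>J. y j = z}. b j)"
proof -
  define W where "W = (x ` I \<union> y ` J) - {z}"
  define p where "p = (\<Prod>w\<in>W. [:- w, 1:])"
  have W: "finite W" using I J by (simp add: W_def)
  have poly_p: "poly p u = (\<Prod>w\<in>W. u - w)" for u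
    by (simp add: p_def poly_prod)
  have c: "poly p z \<noteq> 0" using W by (simp add: poly_p W_def)
  have p0: "poly p u = 0" if "u \<in> W" for u
    using W that by (auto simp: poly_p)
  have ev: "(\<Sum>i\<in>K. d i * poly p (u i)) = (\<Sum>r\<le>degree p. coeff p r * (\<Sum>i\<in>K. d i * u i ^ r))"
    for K and d u :: "'c \<Rightarrow> 'a"
    by (simp add: poly_altdef sum_distrib_left mult_ac) (rule sum.swap)
  have loc: "(\<Sum>i\<in>K. d i * poly p (u i)) = (\<Sum>i\<in>{i\<in>K. u i = z}. d i) * poly p z"
    if "finite K" "u ` K \<subseteq> insert z W" for K and d u :: "'c \<Rightarrow> 'a"
  proof -
    have "(\<Sum>i\<in>K. d i * poly p (u i)) = (\<Sum>i\<in>K. if u i = z then d i * poly p z else 0)"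
      using that p0 by (intro sum.cong refl) auto
    then show ?thesis
      using that by (auto simp: sum.inter_filter sum_distrib_right intro!: sum.cong)
  qed
  have "(\<Sum>i\<in>{i\<in>I. x i = z}. a i) * poly p z = (\<Sum>i\<in>I. a i * poly p (x i))"
    by (rule loc[symmetric]) (use I in \<open>auto simp: W_def\<close>)
  also have "\<dots> = (\<Sum>j\<in>J. b j * poly p (y j))"
    by (simp add: ev eq)
  also have "\<dots> = (\<Sum>j\<in>{j\<in>J. y j = z}. b j) * poly p z"
    by (rule loc) (use J in \<open>auto simp: W_def\<close>)
  finally show ?thesis using c by simp
qed

text \<open>Schur triangularisation puts the roots \<open>es\<close> of the characteristic
  polynomial on the diagonal, so the traces of powers are power sums of \<open>es\<close> with all
  weights 1. Comparing weights at \<open>z\<close> counts the occurrences of \<open>z\<close> in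
  \<open>es\<close>. The values \<open>e j\<close> may repeat.\<close>

lemma order_char_poly_of_traces:
  fixes A :: "complex mat"
  assumes A: "A \<in> carrier_mat n n" and J: "finite J"
    and tr: "\<And>r. (\<Sum>i<n. (A ^\<^sub>m r) $$ (i, i)) = (\<Sum>j\<in>J. d j * e j ^ r)"
  shows "of_nat (Polynomial.order z (char_poly A)) = (\<Sum>j\<in>{j\<in>J. e j = z}. d j)"
proof -
  obtain es where es: "char_poly A = (\<Prod>a\<leftarrow>es. [:- a, 1:])" "length es = n"
    using char_poly_factorized[OF A] by blast
  obtain B P Q where "schur_decomposition A es = (B, P, Q)"
    by (cases "schur_decomposition A es")
  from schur_decomposition[OF A es(1) this]
  have w: "similar_mat_wit A B P Q" and ut: "upper_triangular B" and dB: "diag_mat B = es"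
    by auto
  have B: "B \<in> carrier_mat n n"
    using similar_mat_witD2[OF A w] by simp
  have Bii: "B $$ (i, i) = es ! i" if "i < n" for i
    using that B unfolding dB[symmetric] diag_mat_def by simp
  have "(\<Sum>i<n. 1 * es ! i ^ r) = (\<Sum>j\<in>J. d j * e j ^ r)" for r
  proof -
    have "(\<Sum>i<n. (A ^\<^sub>m r) $$ (i, i)) = (\<Sum>i<n. (B ^\<^sub>m r) $$ (i, i))"
      using similar_mat_wit_pow[OF w] A by (intro trace_similar_mat_wit) auto
    then show ?thesis
      using upper_triangular_pow_mat[OF B ut, of r] Bii tr[of r] by simp
  qed
  from power_sums_determine_weights[OF _ J this, of z]
  have "of_nat (card {i. i < n \<and> es ! i = z}) = (\<Sum>j\<in>{j\<in>J. e j = z}. d j)"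
    by simp
  then show ?thesis by (simp add: es order_prod_linear_factors)
qed

section \<open>Alternating sums over subsets\<close>

lemma sum_Pow_minus_one_power_card:
  assumes "finite X"
  shows "(\<Sum>U\<in>Pow X. (- 1) ^ card U * c ^ card U) = (1 - c :: 'a :: comm_ring_1) ^ card X"
proof -
  have "(\<Sum>U\<in>Pow X. (- 1) ^ card U * c ^ card U) =
      (\<Sum>U\<in>Pow X. (\<Prod>x\<in>U. - c) * (\<Prod>x\<in>X - U. 1))"
    by (simp add: power_mult_distrib[symmetric])
  also have "\<dots> = (\<Prod>x\<in>X. - c + 1)"
    by (rule prod_add[OF assms, symmetric])
  finally show ?thesis by simp
qed

lemma sum_Pow_insert:
  assumes "finite X" "i \<notin> X"
  shows "(\<Sum>U\<in>Pow (insert i X). f U) = (\<Sum>U\<in>Pow X. f U + f (insert i U) :: 'a :: comm_monoid_add)"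
proof -
  have "inj_on (insert i) (Pow X)"
    using assms(2) by (auto simp: inj_on_def)
  then have "(\<Sum>U\<in>insert i ` Pow X. f U) = (\<Sum>U\<in>Pow X. f (insert i U))"
    by (simp add: sum.reindex)
  moreover have "Pow X \<inter> insert i ` Pow X = {}"
    using assms(2) by auto
  ultimately show ?thesis
    using assms(1) by (simp add: Pow_insert sum.union_disjoint sum.distrib)
qed

text \<open>Regrouping by \<open>T = S \<union> U\<close> leaves \<open>f T\<close> times the
  alternating sum over all subsets \<open>U\<close> of \<open>T\<close>, which is zero unless
  \<open>T\<close> is empty.\<close>

lemma sum_Pow_alternating_union:
  fixes f :: "'i set \<Rightarrow> 'a :: comm_ring_1"
  assumes M: "finite M"
  shows "(\<Sum>S\<in>Pow M. \<Sum>U\<in>Pow (M - S). (- 1) ^ card U * f (S \<union> U)) = f {}"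
proof -
  have "(\<Sum>S\<in>Pow M. \<Sum>U\<in>Pow (M - S). (- 1) ^ card U * f (S \<union> U)) =
      (\<Sum>(S, U)\<in>(SIGMA S:Pow M. Pow (M - S)). (- 1) ^ card U * f (S \<union> U))"
    using M by (intro sum.Sigma) auto
  also have "\<dots> = (\<Sum>(T, U)\<in>(SIGMA T:Pow M. Pow T). (- 1) ^ card U * f T)"
    by (rule sum.reindex_bij_witness[where j = "\<lambda>(S, U). (S \<union> U, U)" and i = "\<lambda>(T, U). (T - U, U)"])
       auto
  also have "\<dots> = (\<Sum>T\<in>Pow M. \<Sum>U\<in>Pow T. (- 1) ^ card U * f T)"
    using M by (intro sum.Sigma[symmetric]) (auto dest: finite_subset)
  also have "\<dots> = (\<Sum>T\<in>Pow M. if T = {} then f {} else 0)"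
  proof (intro sum.cong refl)
    fix T assume "T \<in> Pow M"
    then have T: "finite T" using M finite_subset by auto
    have "(\<Sum>U\<in>Pow T. (- 1) ^ card U * f T) = (1 - 1) ^ card T * f T"
      using sum_Pow_minus_one_power_card[OF T, of "1 :: 'a"] by (simp add: sum_distrib_right[symmetric])
    then show "(\<Sum>U\<in>Pow T. (- 1) ^ card U * f T) = (if T = {} then f {} else 0)"
      using T by (simp add: card_gt_0_iff zero_power)
  qed
  also have "\<dots> = f {}" using M by (simp add: sum.delta)
  finally show ?thesis .
qed

section \<open>Ratios of homogeneous tuples and averaging kernels\<close>

locale finite_diagonal = group G for G :: "('a, 'b) monoid_scheme" (structure) +
  fixes m :: nat
  assumes fin: "finite (carrier G)" and m2: "m \<ge> 2"
begin

abbreviation V where "V \<equiv> diag_vertices G m"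
abbreviation M where "M \<equiv> {0..m}"
abbreviation q where "q \<equiv> Coset.order G"

text \<open>For homogenised vertices this set is nonempty exactly when the two vertices share a part
  of the join of the partitions with index in \<open>T\<close>.\<close>

definition ratios :: "nat set \<Rightarrow> (nat \<Rightarrow> 'a) \<Rightarrow> (nat \<Rightarrow> 'a) \<Rightarrow> 'a set" where
  "ratios T l l' = {y \<in> carrier G. \<forall>j\<in>M - T. l' j = y \<otimes> l j}"

text \<open>A vertex is a left coset of the diagonal in \<open>G\<^sup>m\<^sup>+\<^sup>1\<close>, represented by its member with entry
  \<open>\<one>\<close> at index 0. This puts \<open>Q\<^sub>0\<close> on the same footing as the other \<open>Q\<^sub>i\<close>.\<close>

abbreviation homog :: "(nat \<Rightarrow> 'a) \<Rightarrow> nat \<Rightarrow> 'a" where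
  "homog g \<equiv> g(0 := \<one>)"

text \<open>\<open>avg T\<close> is the kernel of the averaging operator over the join of the \<open>Q\<^sub>i\<close> with \<open>i \<in> T\<close>. Counting
  the ratios makes one formula serve all \<open>T\<close>: there is at most one ratio unless \<open>T = M\<close>, when the
  \<open>q\<close> ratios turn the factor \<open>q\<^sup>-\<^sup>(\<^sup>m\<^sup>+\<^sup>1\<^sup>)\<close> into the right one, \<open>q\<^sup>-\<^sup>m\<close>.\<close>

definition avg :: "nat set \<Rightarrow> (nat \<Rightarrow> 'a) \<Rightarrow> (nat \<Rightarrow> 'a) \<Rightarrow> complex" where
  "avg T g h = of_nat (card (ratios T (homog g) (homog h))) / of_nat q ^ card T"

lemma q_pos: "q > 0"
  using fin order_gt_0_iff_finite by blast

lemma finite_V: "finite V"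
  unfolding diag_vertices_def using fin by (intro finite_PiE) auto

lemma card_V: "card V = q ^ m"
  unfolding diag_vertices_def by (simp add: card_PiE Coset.order_def)

lemma finite_ratios: "finite (ratios T l l')"
  using fin by (simp add: ratios_def)

lemma V_carrier: "g \<in> V \<Longrightarrow> j \<in> {1..m} \<Longrightarrow> g j \<in> carrier G"
  by (auto simp: diag_vertices_def)

lemma homog_carrier: "g \<in> V \<Longrightarrow> j \<le> m \<Longrightarrow> homog g j \<in> carrier G"
  by (auto intro: V_carrier)

lemma V_ext: "g \<in> V \<Longrightarrow> h \<in> V \<Longrightarrow> (\<And>j. j \<in> {1..m} \<Longrightarrow> g j = h j) \<Longrightarrow> g = h"
  unfolding diag_vertices_def by (rule PiE_ext)

text \<open>For \<open>i \<noteq> 0\<close> the entry at index 0 forces the ratio to be the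
  identity. For \<open>i = 0\<close> a ratio is a multiplier as in the definition of the partition
  with index 0, unique by cancellation at entry 1.\<close>

lemma ratios_singleton:
  assumes g: "g \<in> V" and h: "h \<in> V" and i: "i \<le> m"
  shows "card (ratios {i} (homog g) (homog h)) = of_bool ((g, h) \<in> diag_rel G m i)"
proof (cases "i = 0")
  case True
  have R: "ratios {i} (homog g) (homog h) = {y \<in> carrier G. \<forall>j\<in>{1..m}. h j = y \<otimes> g j}"
    using True by (auto simp: ratios_def)
  have uniq: "x = y" if "x \<in> ratios {i} (homog g) (homog h)" "y \<in> ratios {i} (homog g) (homog h)" for x y
  proof -
    have 1: "1 \<in> {1..m}" using m2 by simp
    from that 1 have "x \<otimes> g 1 = y \<otimes> g 1" "x \<in> carrier G" "y \<in> carrier G"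
      unfolding R by auto
    then show ?thesis using V_carrier[OF g 1] by simp
  qed
  show ?thesis
  proof (cases "(g, h) \<in> diag_rel G m i")
    case rel: True
    then obtain x where "x \<in> ratios {i} (homog g) (homog h)"
      unfolding R using True by (auto simp: diag_rel_def)
    with uniq have "ratios {i} (homog g) (homog h) = {x}" by auto
    with rel show ?thesis by simp
  next
    case False
    then have "ratios {i} (homog g) (homog h) = {}"
      unfolding R using True g h by (auto simp: diag_rel_def)
    with False show ?thesis by simp
  qed
next
  case False
  have "ratios {i} (homog g) (homog h) = (if (g, h) \<in> diag_rel G m i then {\<one>} else {})"
  proof (intro equalityI subsetI)
    fix y assume y: "y \<in> ratios {i} (homog g) (homog h)"
    moreover have "0 \<in> M - {i}" using False by simp
    ultimately have "homog h 0 = y \<otimes> homog g 0" "y \<in> carrier G"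
      unfolding ratios_def by blast+
    then have "y = \<one>" by simp
    have "h j = g j" if j: "j \<in> {1..m}" "j \<noteq> i" for j
    proof -
      have "j \<in> M - {i}" using j by simp
      then have "homog h j = y \<otimes> homog g j" using y unfolding ratios_def by blast
      then show ?thesis using j \<open>y = \<one>\<close> V_carrier[OF g j(1)] by simp
    qed
    then show "y \<in> (if (g, h) \<in> diag_rel G m i then {\<one>} else {})"
      using False g h \<open>y = \<one>\<close> by (auto simp: diag_rel_def)
  next
    fix y assume "y \<in> (if (g, h) \<in> diag_rel G m i then {\<one>} else {})"
    then show "y \<in> ratios {i} (homog g) (homog h)"
      using False V_carrier[OF g] V_carrier[OF h]
      by (auto simp: diag_rel_def ratios_def split: if_splits)
  qed
  then show ?thesis by simp
qed

lemma ratios_self: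
  assumes g: "g \<in> V" and T: "T \<subseteq> M"
  shows "card (ratios T (homog g) (homog g)) = (if T = M then q else 1)"
proof (cases "T = M")
  case True
  then show ?thesis by (simp add: ratios_def Coset.order_def)
next
  case False
  then obtain j where j: "j \<in> M - T" using T by blast
  have "ratios T (homog g) (homog g) = {\<one>}"
  proof (intro equalityI subsetI)
    fix y assume "y \<in> ratios T (homog g) (homog g)"
    then have "homog g j = y \<otimes> homog g j" "y \<in> carrier G"
      using j unfolding ratios_def by blast+
    then show "y \<in> {\<one>}" using homog_carrier[OF g, of j] j by auto
  qed (use homog_carrier[OF g] in \<open>auto simp: ratios_def\<close>)
  then show ?thesis using False by simp
qed

lemma avg_empty:
  assumes g: "g \<in> V" and h: "h \<in> V"
  shows "avg {} g h = of_bool (g = h)"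
proof (cases "g = h")
  case True
  then show ?thesis using ratios_self[OF g, of "{}"] by (auto simp: avg_def)
next
  case False
  have "y \<notin> ratios {} (homog g) (homog h)" for y
  proof
    assume y: "y \<in> ratios {} (homog g) (homog h)"
    then have "y \<in> carrier G" and eq: "\<And>j. j \<in> M \<Longrightarrow> homog h j = y \<otimes> homog g j"
      unfolding ratios_def by blast+
    with eq[of 0] have "y = \<one>" by simp
    with eq V_carrier[OF g] have "h j = g j" if "j \<in> {1..m}" for j
      using that eq[of j] by auto
    then show False using False V_ext[OF g h] by auto
  qed
  then have "ratios {} (homog g) (homog h) = {}" by auto
  then show ?thesis using False by (simp add: avg_def)
qed

text \<open>With a single ratio per vertex the trace is the first term. For \<open>T = M\<close>
  that term is \<open>1 / q\<close>, while the \<open>q\<close> ratios make the trace 1; the second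
  term is the difference. Kept separate, it affects just one summand of the later alternating
  sum.\<close>

lemma trace_avg:
  assumes T: "T \<subseteq> M"
  shows "(\<Sum>g\<in>V. avg T g g) =
    of_nat q ^ m / of_nat q ^ card T + (if T = M then 1 - 1 / of_nat q else 0)"
  using T q_pos by (simp add: avg_def ratios_self card_V field_simps)

section \<open>Products of averaging kernels\<close>

lemma card_ratios_translate:
  assumes x: "x \<in> carrier G" and l: "\<And>j. j \<in> M \<Longrightarrow> l j \<in> carrier G"
  shows "card (ratios T (\<lambda>j. x \<otimes> l j) l') = card (ratios T l l')"
proof (rule bij_betw_same_card)
  show "bij_betw (\<lambda>y. y \<otimes> x) (ratios T (\<lambda>j. x \<otimes> l j) l') (ratios T l l')"
    by (rule bij_betw_byWitness[where f' = "\<lambda>y. y \<otimes> inv x"])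
       (use x l in \<open>auto simp: ratios_def m_assoc inv_solve_left' simp flip: m_assoc[of _ "inv x" x] m_assoc[of "inv x"]\<close>)
qed

lemma ratios_cong:
  "(\<And>j. j \<in> M - T \<Longrightarrow> l j = k j) \<Longrightarrow> ratios T l l' = ratios T k l'"
  by (auto simp: ratios_def)

text \<open>If \<open>i \<in> T\<close>, entry \<open>i\<close> is never inspected and all
  \<open>q\<close> summands agree. Otherwise each ratio \<open>y\<close> that ignores entry
  \<open>i\<close> is a ratio for exactly one new entry, namely
  \<open>z = inv y \<otimes> l' i\<close>.\<close>

lemma sum_ratios_update:
  assumes i: "i \<in> M" and l': "\<And>j. j \<in> M \<Longrightarrow> l' j \<in> carrier G"
  shows "(\<Sum>z\<in>carrier G. card (ratios T (l(i := z)) l')) =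
    (if i \<in> T then q else 1) * card (ratios (insert i T) l l')"
proof (cases "i \<in> T")
  case True
  then have "ratios T (l(i := z)) l' = ratios T l l'" for z
    by (intro ratios_cong) auto
  then show ?thesis using True by (simp add: insert_absorb Coset.order_def)
next
  case False
  have "(\<Sum>z\<in>carrier G. card (ratios T (l(i := z)) l')) =
      card (SIGMA z:carrier G. ratios T (l(i := z)) l')"
    using fin finite_ratios by (simp add: card_SigmaI)
  also have "\<dots> = card (ratios (insert i T) l l')"
  proof (rule bij_betw_same_card)
    show "bij_betw snd (SIGMA z:carrier G. ratios T (l(i := z)) l') (ratios (insert i T) l l')"
      by (rule bij_betw_byWitness[where f' = "\<lambda>y. (inv y \<otimes> l' i, y)"])
         (use i False l' in \<open>auto simp: ratios_def m_assoc[symmetric]\<close>)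
  qed
  finally show ?thesis using False by simp
qed

text \<open>Running through the part of \<open>g\<close> amounts to letting entry \<open>i\<close>
  of its homogeneous tuple run over the group. For \<open>i = 0\<close> the new tuple must be
  rescaled to have the identity at index 0 again, which leaves the number of ratios
  unchanged.\<close>

lemma sum_singleton_ratios:
  assumes g: "g \<in> V" and i: "i \<in> M"
  shows "(\<Sum>k\<in>V. card (ratios {i} (homog g) (homog k)) * card (ratios T (homog k) l')) =
    (\<Sum>z\<in>carrier G. card (ratios T ((homog g)(i := z)) l'))"
proof (cases "i = 0")
  case True
  define tr where "tr x = (\<lambda>j\<in>{1..m}. x \<otimes> g j)" for x
  have trV: "tr x \<in> V" if "x \<in> carrier G" for x
    using that V_carrier[OF g] by (auto simp: tr_def diag_vertices_def)
  have "(\<Sum>k\<in>V. card (ratios {i} (homog g) (homog k)) * card (ratios T (homog k) l')) =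
      (\<Sum>k\<in>V. \<Sum>x\<in>ratios {i} (homog g) (homog k). card (ratios T (homog k) l'))"
    by simp
  also have "\<dots> = (\<Sum>(k, x)\<in>(SIGMA k:V. ratios {i} (homog g) (homog k)). card (ratios T (homog k) l'))"
    using finite_V finite_ratios by (intro sum.Sigma) auto
  also have "\<dots> = (\<Sum>z\<in>carrier G. card (ratios T (homog (tr (inv z))) l'))"
  \<comment> \<open>The tuple with \<open>z\<close> at index 0 becomes homogeneous after left
    multiplication by \<open>inv z\<close>, which turns the other entries into those of
    \<open>tr (inv z)\<close>. Hence the multiplier \<open>x\<close> corresponds to
    \<open>z = inv x\<close>.\<close>
  proof (rule sum.reindex_bij_witness[where j = "\<lambda>(k, x). inv x" and i = "\<lambda>z. (tr (inv z), inv z)"])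
    fix p assume "p \<in> (SIGMA k:V. ratios {i} (homog g) (homog k))"
    then obtain k x where p: "p = (k, x)" "k \<in> V" "x \<in> carrier G" "\<And>j. j \<in> {1..m} \<Longrightarrow> k j = x \<otimes> g j"
      using True by (auto simp: ratios_def)
    have k: "k = tr x"
      using p trV by (intro V_ext) (auto simp: tr_def)
    show "(tr (inv (case p of (k, x) \<Rightarrow> inv x)), inv (case p of (k, x) \<Rightarrow> inv x)) = p"
      using p(1,3) k by simp
    show "(case p of (k, x) \<Rightarrow> inv x) \<in> carrier G"
      using p by simp
    show "card (ratios T (homog (tr (inv (case p of (k, x) \<Rightarrow> inv x)))) l') =
        (case p of (k, x) \<Rightarrow> card (ratios T (homog k) l'))"
      using p(1,3) k by simp
  next
    fix z assume z: "z \<in> carrier G"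
    then show "(case (tr (inv z), inv z) of (k, x) \<Rightarrow> inv x) = z" by simp
    show "(tr (inv z), inv z) \<in> (SIGMA k:V. ratios {i} (homog g) (homog k))"
      using z trV True by (auto simp: ratios_def tr_def)
  qed
  also have "\<dots> = (\<Sum>z\<in>carrier G. card (ratios T ((homog g)(i := z)) l'))"
  proof (intro sum.cong refl)
    fix z assume z: "z \<in> carrier G"
    have "card (ratios T (homog (tr (inv z))) l') = card (ratios T (\<lambda>j. inv z \<otimes> ((homog g)(i := z)) j) l')"
      using z True by (intro arg_cong[where f = card] ratios_cong) (auto simp: tr_def)
    also have "\<dots> = card (ratios T ((homog g)(i := z)) l')"
      using z V_carrier[OF g] True by (intro card_ratios_translate) auto
    finally show "card (ratios T (homog (tr (inv z))) l') = card (ratios T ((homog g)(i := z)) l')" .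
  qed
  finally show ?thesis .
next
  case False
  then have i1: "i \<in> {1..m}" using i by auto
  have img: "g(i := z) \<in> V" if "z \<in> carrier G" for z
    using g i1 that by (auto simp: diag_vertices_def PiE_iff extensional_def)
  have "(\<Sum>k\<in>V. card (ratios {i} (homog g) (homog k)) * card (ratios T (homog k) l')) =
      (\<Sum>k\<in>V. if (g, k) \<in> diag_rel G m i then card (ratios T (homog k) l') else 0)"
    using g i by (intro sum.cong refl) (simp add: ratios_singleton)
  also have "\<dots> = (\<Sum>k\<in>{k\<in>V. (g, k) \<in> diag_rel G m i}. card (ratios T (homog k) l'))"
    using finite_V by (simp add: sum.inter_filter)
  also have "\<dots> = (\<Sum>z\<in>carrier G. card (ratios T (homog (g(i := z))) l'))"
  proof (rule sum.reindex_bij_witness[where j = "\<lambda>k. k i" and i = "\<lambda>z. g(i := z)"])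
    fix k assume k: "k \<in> {k\<in>V. (g, k) \<in> diag_rel G m i}"
    then have kV: "k \<in> V" and eq: "\<And>j. j \<in> {1..m} \<Longrightarrow> j \<noteq> i \<Longrightarrow> g j = k j"
      using False by (auto simp: diag_rel_def)
    show ki: "k i \<in> carrier G" using V_carrier[OF kV i1] .
    show upd: "g(i := k i) = k"
      by (rule V_ext[OF img[OF ki] kV]) (use eq in auto)
    show "card (ratios T (homog (g(i := k i))) l') = card (ratios T (homog k) l')"
      by (simp add: upd)
  qed (use img g False in \<open>auto simp: diag_rel_def\<close>)
  also have "\<dots> = (\<Sum>z\<in>carrier G. card (ratios T ((homog g)(i := z)) l'))"
    using False by (simp add: fun_upd_twist)
  finally show ?thesis .
qed

text \<open>For \<open>i \<in> T\<close> the factor \<open>q\<close> from the summation cancels the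
  extra \<open>1 / q\<close> of \<open>avg {i}\<close>; for \<open>i \<notin> T\<close> that
  \<open>1 / q\<close> accounts for the larger cardinality of \<open>insert i T\<close>.\<close>

lemma avg_mult:
  assumes g: "g \<in> V" and h: "h \<in> V" and i: "i \<in> M" and T: "T \<subseteq> M"
  shows "(\<Sum>k\<in>V. avg {i} g k * avg T k h) = avg (insert i T) g h"
proof -
  have finT: "finite T" using T finite_subset by blast
  have "(\<Sum>k\<in>V. card (ratios {i} (homog g) (homog k)) * card (ratios T (homog k) (homog h))) =
      (if i \<in> T then q else 1) * card (ratios (insert i T) (homog g) (homog h))"
    unfolding sum_singleton_ratios[OF g i]
    by (rule sum_ratios_update[OF i]) (use homog_carrier[OF h] in auto)
  then have "(\<Sum>k\<in>V. of_nat (card (ratios {i} (homog g) (homog k))) * of_nat (card (ratios T (homog k) (homog h)))) =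
      (of_nat ((if i \<in> T then q else 1) * card (ratios (insert i T) (homog g) (homog h))) :: complex)"
    by (simp flip: of_nat_mult of_nat_sum)
  then show ?thesis
    using finT q_pos
    by (simp add: avg_def sum_divide_distrib[symmetric] card_insert_if insert_absorb)
qed

section \<open>Projections onto the common eigenspaces and their traces\<close>

text \<open>By inclusion-exclusion this is the projection onto the common eigenspace on which \<open>avg {i}\<close> is the
  identity for \<open>i \<in> S\<close> and zero for \<open>i \<in> M - S\<close>.\<close>

definition eig_proj :: "nat set \<Rightarrow> (nat \<Rightarrow> 'a) \<Rightarrow> (nat \<Rightarrow> 'a) \<Rightarrow> complex" where
  "eig_proj S g h = (\<Sum>U\<in>Pow (M - S). (- 1) ^ card U * avg (S \<union> U) g h)"

text \<open>If \<open>i \<in> S\<close>, every term of the projection already absorbs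
  \<open>avg {i}\<close>. Otherwise multiplication by \<open>avg {i}\<close> makes the kernels for
  \<open>U\<close> and \<open>insert i U\<close> equal, and their opposite signs cancel.\<close>

lemma avg_mult_eig_proj:
  assumes g: "g \<in> V" and h: "h \<in> V" and i: "i \<in> M" and S: "S \<subseteq> M"
  shows "(\<Sum>k\<in>V. avg {i} g k * eig_proj S k h) = of_bool (i \<in> S) * eig_proj S g h"
proof -
  have "(\<Sum>k\<in>V. avg {i} g k * eig_proj S k h) =
      (\<Sum>U\<in>Pow (M - S). (- 1) ^ card U * (\<Sum>k\<in>V. avg {i} g k * avg (S \<union> U) k h))"
    unfolding eig_proj_def sum_distrib_left by (subst sum.swap) (simp add: mult_ac)
  also have "\<dots> = (\<Sum>U\<in>Pow (M - S). (- 1) ^ card U * avg (insert i (S \<union> U)) g h)"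
    using S by (intro sum.cong refl arg_cong2[where f = "(*)"] avg_mult[OF g h i]) auto
  also have "\<dots> = of_bool (i \<in> S) * eig_proj S g h"
  proof (cases "i \<in> S")
    case True
    then show ?thesis by (simp add: eig_proj_def insert_absorb)
  next
    case False
    define X where "X = M - S - {i}"
    have X: "finite X" "i \<notin> X" and ins: "M - S = insert i X"
      using False i by (auto simp: X_def)
    have "(- 1) ^ card U * avg (insert i (S \<union> U)) g h +
        (- 1) ^ card (insert i U) * avg (insert i (S \<union> insert i U)) g h = 0" if "U \<in> Pow X" for U
    proof -
      have "finite U" "i \<notin> U" using that X finite_subset by auto
      then show ?thesis by simp
    qed
    then show ?thesis
      unfolding ins sum_Pow_insert[OF X] using False by simp
  qed
  finally show ?thesis .
qed

lemma sum_eig_proj: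
  assumes "g \<in> V" "h \<in> V"
  shows "(\<Sum>S\<in>Pow M. eig_proj S g h) = of_bool (g = h)"
  unfolding eig_proj_def using assms by (subst sum_Pow_alternating_union) (auto simp: avg_empty)

lemma trace_eig_proj:
  assumes S: "S \<subseteq> M"
  defines "n \<equiv> m + 1 - card S"
  shows "(\<Sum>g\<in>V. eig_proj S g g) =
    of_nat q ^ m / of_nat q ^ card S * (1 - 1 / of_nat q) ^ n + (- 1) ^ n * (1 - 1 / of_nat q)"
proof -
  let ?q = "of_nat q :: complex"
  have finS: "finite S" using S finite_subset by blast
  have n: "card (M - S) = n" using S finS by (simp add: card_Diff_subset n_def)
  have "(\<Sum>g\<in>V. eig_proj S g g) = (\<Sum>U\<in>Pow (M - S). (- 1) ^ card U * (\<Sum>g\<in>V. avg (S \<union> U) g g))"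
    unfolding eig_proj_def by (subst sum.swap) (simp add: sum_distrib_left)
  \<comment> \<open>The correction in \<open>trace_avg\<close> enters only when
    \<open>S \<union> U = M\<close>, that is, for \<open>U = M - S\<close>. The rest is a binomial
    sum with ratio \<open>1 / q\<close>.\<close>
  also have "\<dots> = (\<Sum>U\<in>Pow (M - S). ?q ^ m / ?q ^ card S * ((- 1) ^ card U * (1 / ?q) ^ card U) +
      (if U = M - S then (- 1) ^ n * (1 - 1 / ?q) else 0))"
  proof (intro sum.cong refl)
    fix U assume U: "U \<in> Pow (M - S)"
    then have "finite U" "S \<inter> U = {}" using finite_subset by auto
    then have "card (S \<union> U) = card S + card U" using finS by (simp add: card_Un_disjoint)
    moreover have "S \<union> U = M \<longleftrightarrow> U = M - S" using U S by auto
    ultimately show "(- 1) ^ card U * (\<Sum>g\<in>V. avg (S \<union> U) g g) =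
        ?q ^ m / ?q ^ card S * ((- 1) ^ card U * (1 / ?q) ^ card U) +
        (if U = M - S then (- 1) ^ n * (1 - 1 / ?q) else 0)"
      using U S by (subst trace_avg) (auto simp: n power_add power_divide algebra_simps)
  qed
  also have "\<dots> = ?q ^ m / ?q ^ card S * (1 - 1 / ?q) ^ n + (- 1) ^ n * (1 - 1 / ?q)"
    unfolding sum.distrib sum_distrib_left[symmetric]
    by (subst sum_Pow_minus_one_power_card) (auto simp: n sum.delta')
  finally show ?thesis .
qed

section \<open>The adjacency matrix as a sum of averaging kernels\<close>

lemma parcs_diagonal_graph_iff:
  "(g, h) \<in> parcs (diagonal_graph G m) \<longleftrightarrow> g \<noteq> h \<and> (\<exists>i\<in>M. (g, h) \<in> diag_rel G m i)"
proof -
  have "(\<exists>P\<in>diag_partition G m i. g \<in> P \<and> h \<in> P) \<longleftrightarrow> (g, h) \<in> diag_rel G m i" for i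
  proof -
    have eq: "equiv V (diag_rel G m i)" by (rule equiv_diag_rel) (rule group_axioms)
    show ?thesis
    proof
      assume "\<exists>P\<in>diag_partition G m i. g \<in> P \<and> h \<in> P"
      then show "(g, h) \<in> diag_rel G m i"
        using quotient_eq_iff[OF eq] unfolding diag_partition_def by blast
    next
      assume r: "(g, h) \<in> diag_rel G m i"
      then have "g \<in> V" by (auto simp: diag_rel_def)
      then show "\<exists>P\<in>diag_partition G m i. g \<in> P \<and> h \<in> P"
        using r equiv_class_self[OF eq] unfolding diag_partition_def
        by (intro bexI[of _ "diag_rel G m i `` {g}"]) (auto intro: quotientI)
    qed
  qed
  moreover have "(g, h) \<in> diag_rel G m i \<Longrightarrow> g \<in> V \<and> h \<in> V" for i
    by (auto simp: diag_rel_def)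
  ultimately show ?thesis
    unfolding diagonal_graph_def by auto
qed

text \<open>For two nonzero indices, each coordinate is fixed by at least one of the relations. For
  index 0 against \<open>j\<close>, the bound \<open>m \<ge> 2\<close> supplies a coordinate other
  than \<open>j\<close>, and there the multiplier is seen to be the identity.\<close>

lemma diag_rel_unique:
  assumes g: "g \<in> V" and ne: "g \<noteq> h"
    and i: "i \<in> M" "(g, h) \<in> diag_rel G m i" and j: "j \<in> M" "(g, h) \<in> diag_rel G m j"
  shows "i = j"
proof (rule ccontr)
  assume "i \<noteq> j"
  have h: "h \<in> V" using i by (auto simp: diag_rel_def)
  \<comment> \<open>Two distinct indices are not both 0, so up to swapping them the second is
    nonzero.\<close>
  have False if i: "(g, h) \<in> diag_rel G m i" and j: "(g, h) \<in> diag_rel G m j" and "i \<noteq> j" "j \<noteq> 0" for i j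
  proof (cases "i = 0")
    case True
    then obtain x where x: "x \<in> carrier G" "\<And>l. l \<in> {1..m} \<Longrightarrow> h l = x \<otimes> g l"
      using i by (auto simp: diag_rel_def)
    define l where "l = (if j = 1 then 2 else 1 :: nat)"
    have l: "l \<in> {1..m}" "l \<noteq> j" using m2 by (auto simp: l_def)
    then have "g l = x \<otimes> g l" using j x(2)[OF l(1)] \<open>j \<noteq> 0\<close> by (auto simp: diag_rel_def)
    then have "x = \<one>" using x(1) V_carrier[OF g l(1)] by simp
    then have "g l = h l" if "l \<in> {1..m}" for l using x(2)[OF that] V_carrier[OF g that] by simp
    then show False using V_ext[OF g h] ne by blast
  next
    case False
    then have "g l = h l" if "l \<in> {1..m}" for l
      using that i j \<open>i \<noteq> j\<close> \<open>j \<noteq> 0\<close> by (cases "l = i") (auto simp: diag_rel_def)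
    then show False using V_ext[OF g h] ne by blast
  qed
  from this[of i j] this[of j i] show False
    using i(2) j(2) \<open>i \<noteq> j\<close> by (cases "j = 0") auto
qed

text \<open>\<open>of_nat q * avg {i}\<close> is the indicator of the relation with index
  \<open>i\<close>. On the diagonal every summand is \<open>1 - 1\<close>; off it, at most one index
  contributes.\<close>

lemma adjacency_eq_sum_avg:
  assumes g: "g \<in> V" and h: "h \<in> V"
  shows "of_bool ((g, h) \<in> parcs (diagonal_graph G m)) =
    (\<Sum>i\<in>M. of_nat q * avg {i} g h - of_bool (g = h))"
proof -
  have "of_nat q * avg {i} g h = of_bool ((g, h) \<in> diag_rel G m i)" if "i \<in> M" for i
    using that q_pos ratios_singleton[OF g h, of i] by (simp add: avg_def)
  then have eq: "(\<Sum>i\<in>M. of_nat q * avg {i} g h - of_bool (g = h)) =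
      (\<Sum>i\<in>M. of_bool ((g, h) \<in> diag_rel G m i) - of_bool (g = h) :: complex)"
    by (intro sum.cong refl) simp
  show ?thesis
  proof (cases "g = h")
    case True
    then have "(g, h) \<in> diag_rel G m i" for i
      using equiv_diag_rel[OF group_axioms, of m i] g by (auto simp: equiv_def refl_on_def)
    then show ?thesis unfolding eq using True by (simp add: parcs_diagonal_graph_iff)
  next
    case ne: False
    show ?thesis
    proof (cases "\<exists>i\<in>M. (g, h) \<in> diag_rel G m i")
      case True
      then obtain i where i: "i \<in> M" "(g, h) \<in> diag_rel G m i" by blast
      then have "(\<Sum>j\<in>M. of_bool ((g, h) \<in> diag_rel G m j) :: complex) = (\<Sum>j\<in>M. if j = i then 1 else 0)"
        using diag_rel_unique[OF g ne] by (intro sum.cong refl) auto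
      then show ?thesis unfolding eq using i ne True by (simp add: parcs_diagonal_graph_iff sum.delta)
    next
      case False
      then show ?thesis unfolding eq using ne by (simp add: parcs_diagonal_graph_iff)
    qed
  qed
qed

text \<open>On the piece of \<open>S\<close>, the summand for \<open>i\<close> acts as
  \<open>q - 1\<close> if \<open>i \<in> S\<close> and as \<open>-1\<close> otherwise.\<close>

lemma adjacency_mult_eig_proj:
  assumes g: "g \<in> V" and h: "h \<in> V" and S: "S \<subseteq> M"
  shows "(\<Sum>k\<in>V. of_bool ((g, k) \<in> parcs (diagonal_graph G m)) * eig_proj S k h) =
    (- of_nat (m + 1) + of_nat (card S) * of_nat q) * eig_proj S g h"
proof -
  have one: "(\<Sum>k\<in>V. of_bool (g = k) * eig_proj S k h) = eig_proj S g h"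
  proof -
    have "(\<Sum>k\<in>V. of_bool (g = k) * eig_proj S k h) = (\<Sum>k\<in>V. if g = k then eig_proj S k h else 0)"
      by (intro sum.cong refl) simp
    then show ?thesis using finite_V g by (simp add: sum.delta')
  qed
  have "(\<Sum>k\<in>V. of_bool ((g, k) \<in> parcs (diagonal_graph G m)) * eig_proj S k h) =
      (\<Sum>k\<in>V. \<Sum>i\<in>M. (of_nat q * avg {i} g k - of_bool (g = k)) * eig_proj S k h)"
    using g by (intro sum.cong refl) (simp only: adjacency_eq_sum_avg sum_distrib_right)
  also have "\<dots> = (\<Sum>i\<in>M. \<Sum>k\<in>V. (of_nat q * avg {i} g k - of_bool (g = k)) * eig_proj S k h)"
    by (rule sum.swap)
  also have "\<dots> = (\<Sum>i\<in>M. of_nat q * (of_bool (i \<in> S) * eig_proj S g h) - eig_proj S g h)"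
    by (intro sum.cong refl)
       (simp only: left_diff_distrib sum_subtractf mult.assoc one avg_mult_eig_proj[OF g h _ S]
         sum_distrib_left[symmetric])
  also have "\<dots> = of_nat q * ((\<Sum>i\<in>M. of_bool (i \<in> S)) * eig_proj S g h) - (\<Sum>i\<in>M. eig_proj S g h)"
    by (simp only: sum_subtractf sum_distrib_left sum_distrib_right)
  also have "(\<Sum>i\<in>M. of_bool (i \<in> S)) = (of_nat (card S) :: complex)"
    using S by (simp add: of_bool_def sum.If_cases Int_absorb1)
  finally show ?thesis by (simp add: algebra_simps)
qed

section \<open>Spectral expansion of the powers and the resulting multiplicities\<close>

lemma adjacency_matrix_pow_entry:
  fixes vs
  defines "A \<equiv> adjacency_matrix (diagonal_graph G m) vs :: complex mat"
  assumes vs: "distinct vs" "set vs = V" and i: "i < length vs" and j: "j < length vs"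
  shows "(A ^\<^sub>m r) $$ (i, j) =
    (\<Sum>S\<in>Pow M. (- of_nat (m + 1) + of_nat (card S) * of_nat q) ^ r * eig_proj S (vs ! i) (vs ! j))"
  using i j
proof (induction r arbitrary: i j)
  case 0
  have "dim_row A = length vs"
    by (simp add: A_def adjacency_matrix_def)
  moreover have "vs ! i \<in> V" "vs ! j \<in> V"
    using 0 vs(2) nth_mem by blast+
  ultimately show ?case
    using 0 vs(1) by (simp add: sum_eig_proj nth_eq_iff_index_eq)
next
  case (Suc r)
  define n where "n = length vs"
  define ev where "ev S = (- of_nat (m + 1) + of_nat (card S) * of_nat q :: complex)" for S :: "nat set"
  have A: "A \<in> carrier_mat n n"
    by (simp add: A_def adjacency_matrix_def n_def)
  have mem: "vs ! i \<in> V" "vs ! j \<in> V"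
    using Suc.prems vs(2) nth_mem by blast+
  have bij: "bij_betw ((!) vs) {..<n} V"
    using bij_betw_nth[OF vs(1), of "{..<n}" V] vs(2) by (simp add: n_def)
  \<comment> \<open>With the new factor on the left, the induction hypothesis expands the remaining
    power into projections, each of which the new factor multiplies by its eigenvalue.\<close>
  have "(A ^\<^sub>m Suc r) $$ (i, j) = (\<Sum>k<n. A $$ (i, k) * (A ^\<^sub>m r) $$ (k, j))"
    unfolding pow_mat_Suc_left[OF A]
    using A Suc.prems by (simp add: scalar_prod_def atLeast0LessThan n_def[symmetric])
  also have "\<dots> = (\<Sum>k<n. of_bool ((vs ! i, vs ! k) \<in> parcs (diagonal_graph G m)) *
      (\<Sum>S\<in>Pow M. ev S ^ r * eig_proj S (vs ! k) (vs ! j)))"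
    using Suc by (intro sum.cong refl arg_cong2[where f = "(*)"])
      (auto simp: A_def adjacency_matrix_def n_def ev_def)
  also have "\<dots> = (\<Sum>k\<in>V. of_bool ((vs ! i, k) \<in> parcs (diagonal_graph G m)) *
      (\<Sum>S\<in>Pow M. ev S ^ r * eig_proj S k (vs ! j)))"
    by (rule sum.reindex_bij_betw[OF bij])
  also have "\<dots> = (\<Sum>S\<in>Pow M. ev S ^ r *
      (\<Sum>k\<in>V. of_bool ((vs ! i, k) \<in> parcs (diagonal_graph G m)) * eig_proj S k (vs ! j)))"
    unfolding sum_distrib_left by (subst sum.swap) (simp add: mult.left_commute)
  also have "\<dots> = (\<Sum>S\<in>Pow M. ev S ^ Suc r * eig_proj S (vs ! i) (vs ! j))"
    using mem by (intro sum.cong refl) (simp add: adjacency_mult_eig_proj ev_def)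
  finally show ?case by (simp only: ev_def)
qed

text \<open>Stated for arbitrary \<open>z\<close>: if no subset \<open>S\<close> yields the value
  \<open>z\<close>, the sum is empty and the order is 0. This is what excludes further
  eigenvalues.\<close>

lemma order_char_poly_adjacency:
  fixes vs
  defines "A \<equiv> adjacency_matrix (diagonal_graph G m) vs :: complex mat"
    and "ev \<equiv> \<lambda>k. - of_nat (m + 1) + of_nat k * of_nat q :: complex"
  assumes vs: "distinct vs" "set vs = V"
  shows "of_nat (Polynomial.order z (char_poly A)) =
    (\<Sum>S\<in>{S\<in>Pow M. ev (card S) = z}. \<Sum>g\<in>V. eig_proj S g g)"
proof (rule order_char_poly_of_traces)
  show "A \<in> carrier_mat (length vs) (length vs)"
    by (simp add: A_def adjacency_matrix_def)
  show "(\<Sum>i<length vs. (A ^\<^sub>m r) $$ (i, i)) =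
      (\<Sum>S\<in>Pow M. (\<Sum>g\<in>V. eig_proj S g g) * ev (card S) ^ r)" for r
  proof -
    have bij: "bij_betw ((!) vs) {..<length vs} V"
      using bij_betw_nth[OF vs(1), of "{..<length vs}" V] vs(2) by simp
    have "(\<Sum>i<length vs. (A ^\<^sub>m r) $$ (i, i)) =
        (\<Sum>i<length vs. \<Sum>S\<in>Pow M. ev (card S) ^ r * eig_proj S (vs ! i) (vs ! i))"
      using vs unfolding A_def ev_def by (intro sum.cong refl adjacency_matrix_pow_entry) auto
    also have "\<dots> = (\<Sum>g\<in>V. \<Sum>S\<in>Pow M. ev (card S) ^ r * eig_proj S g g)"
      by (rule sum.reindex_bij_betw[OF bij])
    also have "\<dots> = (\<Sum>S\<in>Pow M. (\<Sum>g\<in>V. eig_proj S g g) * ev (card S) ^ r)"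
      unfolding sum_distrib_right by (subst sum.swap) (simp add: mult.commute)
    finally show ?thesis .
  qed
qed simp

lemma order_eq_choose_times_trace:
  fixes vs
  defines "A \<equiv> adjacency_matrix (diagonal_graph G m) vs :: complex mat"
  assumes vs: "distinct vs" "set vs = V" and k: "k \<le> m + 1"
  shows "of_nat (Polynomial.order (- of_nat (m + 1) + of_nat k * of_nat q) (char_poly A)) =
    of_nat ((m + 1) choose k) *
    (of_nat q ^ m / of_nat q ^ k * (1 - 1 / of_nat q) ^ (m + 1 - k) +
      (- 1) ^ (m + 1 - k) * (1 - 1 / of_nat q) :: complex)"
proof -
  \<comment> \<open>Since \<open>q > 0\<close>, different cardinalities give different
    eigenvalues.\<close>
  have S: "{S \<in> Pow M. - of_nat (m + 1) + of_nat (card S) * of_nat q =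
      (- of_nat (m + 1) + of_nat k * of_nat q :: complex)} = {S. S \<subseteq> M \<and> card S = k}"
    using q_pos by auto
  have "card {S. S \<subseteq> M \<and> card S = k} = (m + 1) choose k"
    using n_subsets[of M k] by simp
  then show ?thesis
    unfolding A_def order_char_poly_adjacency[OF vs] S by (simp add: trace_eig_proj)
qed

text \<open>The bound matters: at \<open>k = m + 1\<close> the left side is 1, but truncated
  subtraction turns the right side into 0.\<close>

lemma trace_formula_le:
  assumes "k \<le> m"
  shows "(of_nat q ^ m / of_nat q ^ k * (1 - 1 / of_nat q) ^ (m + 1 - k) +
      (- 1) ^ (m + 1 - k) * (1 - 1 / of_nat q) :: complex) =
    inverse (of_nat q) * (of_nat q - 1) * ((of_nat q - 1) ^ (m - k) - (- 1) ^ (m - k))"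
proof -
  let ?q = "of_nat q :: complex"
  obtain l where m: "m = k + l" using assms le_Suc_ex by blast
  have q: "?q \<noteq> 0" using q_pos by simp
  have "1 - 1 / ?q = (?q - 1) / ?q" using q by (simp add: field_simps)
  moreover have "?q ^ m / ?q ^ k = ?q ^ l" using q by (simp add: m power_add)
  moreover have "m + 1 - k = Suc l" "m - k = l" using m by auto
  ultimately have "?q ^ m / ?q ^ k * (1 - 1 / ?q) ^ (m + 1 - k) + (- 1) ^ (m + 1 - k) * (1 - 1 / ?q) =
      ?q ^ l * ((?q - 1) / ?q) ^ Suc l + (- 1) ^ Suc l * ((?q - 1) / ?q)"
    by (simp only:)
  also have "\<dots> = inverse ?q * (?q - 1) * ((?q - 1) ^ l - (- 1) ^ l)"
    using q by (simp add: power_divide field_simps)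
  finally show ?thesis using \<open>m - k = l\<close> by (simp only:)
qed

end

section \<open>The complete spectrum\<close>

theorem theorem5p1:
  fixes G :: "('a, 'b) monoid_scheme"
    and m q :: nat
    and vs :: "(nat \<Rightarrow> 'a) list"
  assumes "m \<ge> 2"
    and "Group.group G"
    and "finite (carrier G)"
    and "Coset.order G = q"
    and "distinct vs"
    and "set vs = pverts (diagonal_graph G m)"
  shows "let A = (adjacency_matrix (diagonal_graph G m) vs :: complex mat);
             ev = (\<lambda>k :: nat. - of_nat (m + 1) + of_nat k * of_nat q);
             mult = (\<lambda>k :: nat. of_nat ((m + 1) choose k) * inverse (of_nat q) * (of_nat q - 1) *
               ((of_nat q - 1) ^ (m - k) - (- 1) ^ (m - k)) :: complex)
         in (\<forall>k \<in> {0..m - 1}. of_nat (Polynomial.order (ev k) (char_poly A)) = mult k) \<and>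
            Polynomial.order (of_nat (m + 1) * (of_nat q - 1)) (char_poly A) = 1 \<and>
            (\<forall>z. eigenvalue A z \<longleftrightarrow>
               z = of_nat (m + 1) * (of_nat q - 1) \<or>
               (\<exists>k \<in> {0..m - 1}. mult k \<noteq> 0 \<and> z = ev k))"
proof -
  interpret finite_diagonal G m
    using assms(1-3) by (simp add: finite_diagonal_def finite_diagonal_axioms_def)
  note q = assms(4)
  have vs: "distinct vs" "set vs = diag_vertices G m"
    using assms(5,6) by (simp_all add: diagonal_graph_def)
  define A where "A = (adjacency_matrix (diagonal_graph G m) vs :: complex mat)"
  define ev where "ev k = (- of_nat (m + 1) + of_nat k * of_nat q :: complex)" for k :: nat
  define mult where "mult k = (of_nat ((m + 1) choose k) * inverse (of_nat q) * (of_nat q - 1) *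
    ((of_nat q - 1) ^ (m - k) - (- 1) ^ (m - k)) :: complex)" for k :: nat
  define top where "top = (of_nat (m + 1) * (of_nat q - 1) :: complex)"
  have A: "A \<in> carrier_mat (length vs) (length vs)"
    by (simp add: A_def adjacency_matrix_def)
  \<comment> \<open>The top eigenvalue belongs to \<open>S = M\<close>, the piece fixed by all
    averages.\<close>
  have top: "top = ev (m + 1)"
    by (simp add: top_def ev_def algebra_simps)
  have q0: "of_nat q \<noteq> (0 :: complex)"
    using q_pos q by simp
  have order_le: "of_nat (Polynomial.order (ev k) (char_poly A)) = mult k" if "k \<le> m" for k
    using order_eq_choose_times_trace[OF vs, of k] trace_formula_le[OF that] that
    by (simp add: A_def ev_def mult_def q mult.assoc)
  have "of_nat (Polynomial.order top (char_poly A)) =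
      (of_nat q ^ m / of_nat q ^ (m + 1) + (1 - 1 / of_nat q) :: complex)"
    using order_eq_choose_times_trace[OF vs, of "m + 1"]
    unfolding top A_def ev_def q by simp
  also have "\<dots> = of_nat 1"
    using q0 by (simp add: field_simps)
  finally have order_top: "Polynomial.order top (char_poly A) = 1"
    by (simp only: of_nat_eq_iff)
  \<comment> \<open>The characteristic polynomial is monic, hence nonzero, so its roots are exactly
    the points of nonzero order.\<close>
  have ev_iff: "eigenvalue A z \<longleftrightarrow> Polynomial.order z (char_poly A) \<noteq> 0" for z
    using degree_monic_char_poly[OF A]
    by (auto simp: eigenvalue_root_char_poly[OF A] order_root)
  have "eigenvalue A z \<longleftrightarrow> z = top \<or> (\<exists>k\<in>{0..m - 1}. mult k \<noteq> 0 \<and> z = ev k)" for z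
  proof
    assume "eigenvalue A z"
    then have ord: "of_nat (Polynomial.order z (char_poly A)) \<noteq> (0 :: complex)"
      by (simp add: ev_iff)
    have "of_nat (Polynomial.order z (char_poly A)) =
        (\<Sum>S\<in>{S \<in> Pow {0..m}. ev (card S) = z}. \<Sum>g\<in>diag_vertices G m. eig_proj S g g)"
      using order_char_poly_adjacency[OF vs, of z] unfolding A_def ev_def q .
    with ord have "{S \<in> Pow {0..m}. ev (card S) = z} \<noteq> {}"
      by (intro notI) (simp only: sum.empty simp_thms)
    then obtain S where S: "S \<subseteq> {0..m}" "z = ev (card S)" by auto
    have "card S \<le> m + 1"
      using card_mono[OF _ S(1)] by simp
    \<comment> \<open>Subsets of size \<open>m\<close> give a value of multiplicity 0, since both
      powers in the formula have exponent 0. This contradicts \<open>ord\<close> and explains why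
      \<open>k\<close> stops at \<open>m - 1\<close>.\<close>
    then consider "card S = m + 1" | "card S = m" | "card S \<le> m - 1" by linarith
    then show "z = top \<or> (\<exists>k\<in>{0..m - 1}. mult k \<noteq> 0 \<and> z = ev k)"
    proof cases
      case 2
      then have "mult (card S) = 0" by (simp add: mult_def)
      with ord order_le[of m] S 2 show ?thesis by simp
    next
      case 3
      with ord order_le[of "card S"] S show ?thesis by auto
    qed (use S top in simp)
  next
    assume "z = top \<or> (\<exists>k\<in>{0..m - 1}. mult k \<noteq> 0 \<and> z = ev k)"
    then show "eigenvalue A z"
    proof
      assume "\<exists>k\<in>{0..m - 1}. mult k \<noteq> 0 \<and> z = ev k"
      then obtain k where k: "k \<in> {0..m - 1}" "mult k \<noteq> 0" "z = ev k" by blast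
      then have "k \<le> m" by simp
      with k have "of_nat (Polynomial.order z (char_poly A)) \<noteq> (0 :: complex)"
        using order_le by simp
      then show ?thesis by (simp add: ev_iff)
    qed (simp add: ev_iff order_top)
  qed
  then show ?thesis
    using order_le order_top
    unfolding Let_def A_def[symmetric] ev_def[symmetric] mult_def[symmetric] top_def[symmetric]
    by auto
qed

end
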